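(* Suppose the limiting parameters described in the context arise from a two-stage experiment satisfying the moment conditions, the sampling design conditions, and the constant weighting regime (when $\mathcal W=\mathcal C$) or the adaptive weighting regime (when $\mathcal W=\mathcal A$). Then for each $\mathcal V\in\{\mathcal U,\mathcal N\}$ and $\mathcal W\in\{\mathcal A,\mathcal C\}$, $$d_{W_1}\big(\mathbb W_{\mathcal V}^{\mathcal W}(-\infty),\mathbb W_{\mathcal V}^{\mathcal W}(c)\big)\to0\quad\text{as }c\to-\infty.$$
   Context: **1-Wasserstein distance.** $d_{W_1}(X,Y)=\sup_{\|f\|_{\mathrm L}\le1}|\mathbb E[f(X)]-\mathbb E[f(Y)]|$, where $\|f\|_{\mathrm L}$ is the Lipschitz constant of $f:\mathbb R\to\mathbb R$. **Setting and parameters.** In a two-stage experiment with $N=N_1+N_2$ units and fixed stage proportions $q_t=N_t/N\in(0,1)$, $q_1+q_2=1$, units have potential outcomes distributed as $(Y_{uN}(0),Y_{uN}(1))$ (law may depend on $N$), pilot treatment probabilities are $e(s)$, $s\in\{0,1\}$, $e(0)+e(1)=1$, and the follow-up probability of treatment $0$ is $\min\{1-l_N,\max\{l_N,e(0,x)\}\}$ at a pilot statistic $x$, where $l_N\in[0,1/2)$ and $e(s,x)\in[0,1]$ is a sampling function on $\bar{\mathbb R}=\mathbb R\cup\{-\infty\}$. **Moment conditions.** For $s\in\{0,1\}$: $0<\inf_N(\mathbb E[Y_{uN}^2(s)]-\mathbb E[Y_{uN}(s)]^2)\le\sup_N(\mathbb E[Y_{uN}^4(s)])^{1/2}<\infty$;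 the limits $\mu_s=\lim_N\mathbb E[Y_{uN}(s)]$ and $\nu_s=\lim_N\mathbb E[Y_{uN}^2(s)]$ exist; and $\sqrt N(\mathbb E[Y_{uN}(0)]-\mathbb E[Y_{uN}(1)])$ converges in $[-\infty,0]$. **Sampling design conditions.** There are $0<c_l<c_u<1$ with $e(s)\in(c_l,c_u)$; $e(0,x)+e(1,x)=1$ for all $x\in\bar{\mathbb R}$; and one of the following holds. (Lipschitz) For each $s$, $e(s,\cdot)$ is Lipschitz over $\bar{\mathbb R}$ with a universal constant $L>0$ (Lipschitz on $\mathbb R$ and continuous at $-\infty$), and $e(s,-\infty)\in\{0,1\}$. (Step function) There exist $m_1\in\mathbb R$, $K\in\mathbb N$ and a continuous $g:\bar{\mathbb R}\to\bar{\mathbb R}$ with $g(-\infty)=-\infty$ such that for each $s$, $e(s,x)=\sum_{k=1}^Kc_k(s)\mathbf 1(g(x)\in C_k)$, where $c_k(s)\in[0,1]$, the $C_k$ are disjoint, $C_1=[-\infty,m_1]$, $C_k$ is open for $k\ge2$, and $\bigcup_{k=2}^KC_k=(m_1,\infty)$. **Regimes.** Constant weighting regime ($\mathcal W=\mathcal C$): $l_N=\bar l$ for all $N$ with $\bar l\in(0,1/2)$ constant. Adaptive weighting regime ($\mathcal W=\mathcal A$): $l_N\in(0,1/2)$, $l_N\to0$, $Nl_N\to\infty$. Let $l_\infty=\lim_Nl_N$. **Limit laws as functions of $c\in[-\infty,0]$** (with $q_t,e(s),e(s,\cdot),\mu_s,\nu_s,l_\infty$ held fixed). Put $H^{(1)}(s)=e(s)$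 and $V^{(t)}(s)=\nu_s-H^{(t)}(s)\mu_s^2$. Let $A^{(1)}=(A^{(1)}(0),A^{(1)}(1))\sim N(0,\Sigma^{(1)})$, and given $A^{(1)}$ let $A^{(2)}=(A^{(2)}(0),A^{(2)}(1))\sim N(0,\Sigma^{(2)}(A^{(1)}))$, where $\Sigma^{(t)}$ is the $2\times2$ matrix with unit diagonal and off-diagonal entries $\mathrm{Cov}^{(t)}=-\big(\tfrac{H^{(t)}(0)H^{(t)}(1)}{V^{(t)}(0)V^{(t)}(1)}\big)^{1/2}\mu_0\mu_1$. Here $H^{(2)}(s)=\min\{1-l_\infty,\max\{l_\infty,e(s,\mathcal S^\infty)\}\}$ with $\mathcal S^\infty=A^{(1)}(0)\big(V^{(1)}(0)/e(0)\big)^{1/2}-A^{(1)}(1)\big(V^{(1)}(1)/e(1)\big)^{1/2}+q_1^{1/2}c$ (equal to $-\infty$ if $c=-\infty$). Weights: $\bar w_{\mathcal C}^{(t)}(s)=(q_tV^{(t)}(s)/H^{(t)}(s))^{1/2}$ and $\bar w_{\mathcal A}^{(t)}(s)=(q_tV^{(t)}(s))^{1/2}/\sum_{t'=1}^2q_{t'}(H^{(t')}(s))^{1/2}$. Then $\mathbb W_{\mathcal U}^{\mathcal W}(c)=\sum_{t=1}^2A^{(t)}(0)\bar w_{\mathcal W}^{(t)}(0)-\sum_{t=1}^2A^{(t)}(1)\bar w_{\mathcal W}^{(t)}(1)$ and $\mathbb W_{\mathcal N}^{\mathcal W}(c)=\mathbb W_{\mathcal U}^{\mathcal W}(c)/\big(\sum_{s=0}^1\sum_{t=1}^2(\bar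 w_{\mathcal W}^{(t)}(s))^2\big)^{1/2}$. *)

theory Defs
  imports "HOL-Probability.Probability"
begin

text \<open>
  The 1-Wasserstein distance, as a function of the two laws. The supremum is taken in the extended
  reals. The Bochner integral has the default value 0 on non-integrable functions, so the definition
  is meaningful for laws with a finite first moment; then every Lipschitz function is integrable.
\<close>

definition wasserstein1 :: "real measure \<Rightarrow> real measure \<Rightarrow> ereal" where
  "wasserstein1 \<mu> \<nu> =
     (SUP f \<in> {f :: real \<Rightarrow> real. 1-lipschitz_on UNIV f}.
        ereal \<bar>(\<integral>x. f x \<partial>\<mu>) - (\<integral>x. f x \<partial>\<nu>)\<bar>)"

text \<open>
  The normal law $N(0,\Sigma)$ for a positive definite covariance matrix.
\<close>

definition centered_normal :: "real ^ 'n ^ 'n \<Rightarrow> (real ^ 'n) measure" where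
  "centered_normal \<Sigma> =
     density lborel (\<lambda>x. ennreal (exp (- (x \<bullet> (matrix_inv \<Sigma> *v x)) / 2)
                                  / sqrt ((2 * pi) ^ CARD('n) * det \<Sigma>)))"

text \<open>
  The half-extended line $\mathbb{R} \cup \{-\infty\}$. Functions on it are represented by functions
  on \<^typ>\<open>ereal\<close> whose value at \<^term>\<open>\<infinity> :: ereal\<close> is irrelevant.
\<close>

definition rbar :: "ereal set" where
  "rbar = {x. x \<noteq> \<infinity>}"

text \<open>
  The parameters of the limit laws: $q_t$, $e(s)$, $e(s,x)$, $\mu_s$, $\nu_s$ and $l_\infty$.
  Treatment arms $s \in \{0,1\}$ are the elements of the two-element type \<^typ>\<open>2\<close>
  (whose elements are 0 and 1); stages are the natural numbers 1 and 2.
\<close>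

record limit_params =
  stage_prop :: "nat \<Rightarrow> real"
  pilot_prob :: "2 \<Rightarrow> real"
  sampling :: "2 \<Rightarrow> ereal \<Rightarrow> real"
  lim_mean :: "2 \<Rightarrow> real"
  lim_second :: "2 \<Rightarrow> real"
  lim_clip :: real

datatype weighting = Adaptive | Constant

datatype scaling = Unnormalized | Normalized

text \<open>
  Admissible sample sizes. Since $N_t = q_t N$ must be an integer, $N$ runs through an infinite set
  of natural numbers, enumerated increasingly by $n$; \<open>Nt t n\<close> is the size of stage $t$ in the
  $n$-th experiment, and all other quantities depending on $N$ are indexed by $n$ as well.
\<close>

definition total_size :: "(nat \<Rightarrow> nat \<Rightarrow> nat) \<Rightarrow> nat \<Rightarrow> nat" where
  "total_size Nt n = Nt 1 n + Nt 2 n"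

definition two_stage_experiment ::
  "limit_params \<Rightarrow> (nat \<Rightarrow> nat \<Rightarrow> nat) \<Rightarrow> (nat \<Rightarrow> (real ^ 2) measure) \<Rightarrow> (nat \<Rightarrow> real) \<Rightarrow> bool" where
  "two_stage_experiment p Nt P l \<longleftrightarrow>
     strict_mono (total_size Nt) \<and>
     (\<forall>t\<in>{1, 2}. stage_prop p t \<in> {0<..<1} \<and>
        (\<forall>n. stage_prop p t = real (Nt t n) / real (total_size Nt n))) \<and>
     stage_prop p 1 + stage_prop p 2 = 1 \<and>
     (\<forall>n. prob_space (P n) \<and> sets (P n) = sets borel) \<and>
     pilot_prob p 0 + pilot_prob p 1 = 1 \<and>
     (\<forall>s. \<forall>x\<in>rbar. sampling p s x \<in> {0..1}) \<and>
     (\<forall>n. l n \<in> {0..<1/2}) \<and>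
     l \<longlonglongrightarrow> lim_clip p"

text \<open>
  \<open>P n\<close> is the joint law of the potential outcomes; \<open>moment P k s n\<close> is the $k$-th moment of the
  potential outcome under treatment $s$.
\<close>

definition moment :: "(nat \<Rightarrow> (real ^ 2) measure) \<Rightarrow> nat \<Rightarrow> 2 \<Rightarrow> nat \<Rightarrow> real" where
  "moment P k s n = (\<integral>y. (y $ s) ^ k \<partial>P n)"

definition moment_conditions ::
  "limit_params \<Rightarrow> (nat \<Rightarrow> nat \<Rightarrow> nat) \<Rightarrow> (nat \<Rightarrow> (real ^ 2) measure) \<Rightarrow> bool" where
  "moment_conditions p Nt P \<longleftrightarrow>
     (\<forall>s.
        (\<forall>n. integrable (P n) (\<lambda>y. (y $ s) ^ 4)) \<and>
        0 < (INF n. ereal (moment P 2 s n - (moment P 1 s n)\<^sup>2)) \<and>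
        (INF n. ereal (moment P 2 s n - (moment P 1 s n)\<^sup>2))
          \<le> (SUP n. ereal (sqrt (moment P 4 s n))) \<and>
        (SUP n. ereal (sqrt (moment P 4 s n))) < \<infinity> \<and>
        moment P 1 s \<longlonglongrightarrow> lim_mean p s \<and>
        moment P 2 s \<longlonglongrightarrow> lim_second p s) \<and>
     (\<exists>c\<^sub>0 \<le> (0 :: ereal).
        (\<lambda>n. ereal (sqrt (real (total_size Nt n)) * (moment P 1 0 n - moment P 1 1 n)))
          \<longlonglongrightarrow> c\<^sub>0)"

definition lipschitz_design :: "(2 \<Rightarrow> ereal \<Rightarrow> real) \<Rightarrow> bool" where
  "lipschitz_design e \<longleftrightarrow>
     (\<exists>L>0. \<forall>s.
        L-lipschitz_on UNIV (\<lambda>x :: real. e s (ereal x)) \<and>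
        continuous (at (-\<infinity>) within rbar) (e s) \<and>
        e s (-\<infinity>) \<in> {0, 1})"

definition step_design :: "(2 \<Rightarrow> ereal \<Rightarrow> real) \<Rightarrow> bool" where
  "step_design e \<longleftrightarrow>
     (\<exists>(m\<^sub>1 :: real) (K :: nat) (g :: ereal \<Rightarrow> ereal) (c :: nat \<Rightarrow> 2 \<Rightarrow> real) (C :: nat \<Rightarrow> ereal set).
        continuous_on rbar g \<and> g ` rbar \<subseteq> rbar \<and> g (-\<infinity>) = -\<infinity> \<and>
        (\<forall>k\<in>{1..K}. \<forall>s. c k s \<in> {0..1}) \<and>
        disjoint_family_on C {1..K} \<and>
        C 1 = {-\<infinity>..ereal m\<^sub>1} \<and>
        (\<forall>k\<in>{2..K}. open (C k)) \<and>
        (\<Union>k\<in>{2..K}. C k) = {ereal m\<^sub>1<..<\<infinity>} \<and>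
        (\<forall>s. \<forall>x\<in>rbar. e s x = (\<Sum>k=1..K. c k s * indicator (C k) (g x))))"

definition sampling_design_conditions :: "limit_params \<Rightarrow> bool" where
  "sampling_design_conditions p \<longleftrightarrow>
     (\<exists>c\<^sub>l c\<^sub>u. 0 < c\<^sub>l \<and> c\<^sub>l < c\<^sub>u \<and> c\<^sub>u < 1 \<and> (\<forall>s. pilot_prob p s \<in> {c\<^sub>l<..<c\<^sub>u})) \<and>
     (\<forall>x\<in>rbar. sampling p 0 x + sampling p 1 x = 1) \<and>
     (lipschitz_design (sampling p) \<or> step_design (sampling p))"

fun weighting_regime :: "weighting \<Rightarrow> (nat \<Rightarrow> nat \<Rightarrow> nat) \<Rightarrow> (nat \<Rightarrow> real) \<Rightarrow> bool" where
  "weighting_regime Constant Nt l \<longleftrightarrow> (\<exists>lbar\<in>{0<..<1/2}. \<forall>n. l n = lbar)"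
| "weighting_regime Adaptive Nt l \<longleftrightarrow>
     (\<forall>n. l n \<in> {0<..<1/2}) \<and> l \<longlonglongrightarrow> 0 \<and>
     filterlim (\<lambda>n. real (total_size Nt n) * l n) at_top sequentially"

text \<open>
  Below, \<open>h s\<close> stands for $H^{(t)}(s)$ at a fixed stage, \<open>H t s\<close> for $H^{(t)}(s)$ at both stages,
  and \<open>a\<close>, \<open>a\<^sub>1\<close>, \<open>a\<^sub>2\<close>, \<open>A t\<close> for realizations of the Gaussian vectors.
\<close>

definition lim_var :: "limit_params \<Rightarrow> (2 \<Rightarrow> real) \<Rightarrow> 2 \<Rightarrow> real" where
  "lim_var p h s = lim_second p s - h s * (lim_mean p s)\<^sup>2"

definition lim_cov :: "limit_params \<Rightarrow> (2 \<Rightarrow> real) \<Rightarrow> real" where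
  "lim_cov p h =
     - sqrt ((h 0 * h 1) / (lim_var p h 0 * lim_var p h 1)) * lim_mean p 0 * lim_mean p 1"

definition lim_Sigma :: "limit_params \<Rightarrow> (2 \<Rightarrow> real) \<Rightarrow> real ^ 2 ^ 2" where
  "lim_Sigma p h = (\<chi> i j. if i = j then 1 else lim_cov p h)"

text \<open>
  As $q_1 > 0$, extended real arithmetic gives \<open>lim_pilot_stat p (-\<infinity>) a = -\<infinity>\<close>.
\<close>

definition lim_pilot_stat :: "limit_params \<Rightarrow> ereal \<Rightarrow> real ^ 2 \<Rightarrow> ereal" where
  "lim_pilot_stat p c a =
     ereal (a $ 0 * sqrt (lim_var p (pilot_prob p) 0 / pilot_prob p 0)
          - a $ 1 * sqrt (lim_var p (pilot_prob p) 1 / pilot_prob p 1))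
     + ereal (sqrt (stage_prop p 1)) * c"

definition followup_prob :: "limit_params \<Rightarrow> ereal \<Rightarrow> real ^ 2 \<Rightarrow> 2 \<Rightarrow> real" where
  "followup_prob p c a s =
     min (1 - lim_clip p) (max (lim_clip p) (sampling p s (lim_pilot_stat p c a)))"

fun weight :: "weighting \<Rightarrow> limit_params \<Rightarrow> (nat \<Rightarrow> 2 \<Rightarrow> real) \<Rightarrow> nat \<Rightarrow> 2 \<Rightarrow> real" where
  "weight Constant p H t s = sqrt (stage_prop p t * lim_var p (H t) s / H t s)"
| "weight Adaptive p H t s =
     sqrt (stage_prop p t * lim_var p (H t) s) / (\<Sum>t'=1..2. stage_prop p t' * sqrt (H t' s))"

definition unnormalized_stat ::
  "weighting \<Rightarrow> limit_params \<Rightarrow> (nat \<Rightarrow> 2 \<Rightarrow> real) \<Rightarrow> (nat \<Rightarrow> real ^ 2) \<Rightarrow> real" where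
  "unnormalized_stat w p H A =
     (\<Sum>t=1..2. A t $ 0 * weight w p H t 0) - (\<Sum>t=1..2. A t $ 1 * weight w p H t 1)"

fun weighted_stat ::
  "scaling \<Rightarrow> weighting \<Rightarrow> limit_params \<Rightarrow> (nat \<Rightarrow> 2 \<Rightarrow> real) \<Rightarrow> (nat \<Rightarrow> real ^ 2) \<Rightarrow> real" where
  "weighted_stat Unnormalized w p H A = unnormalized_stat w p H A"
| "weighted_stat Normalized w p H A =
     unnormalized_stat w p H A / sqrt (\<Sum>s\<in>UNIV. \<Sum>t=1..2. (weight w p H t s)\<^sup>2)"

text \<open>
  The joint law of $(A^{(1)}, A^{(2)})$, given by the marginal law of $A^{(1)}$ and the conditional
  law of $A^{(2)}$ given $A^{(1)}$.
\<close>

definition joint_law :: "limit_params \<Rightarrow> ereal \<Rightarrow> ((real ^ 2) \<times> (real ^ 2)) measure" where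
  "joint_law p c =
     centered_normal (lim_Sigma p (pilot_prob p)) \<bind> (\<lambda>a\<^sub>1.
       centered_normal (lim_Sigma p (followup_prob p c a\<^sub>1)) \<bind> (\<lambda>a\<^sub>2.
         return borel (a\<^sub>1, a\<^sub>2)))"

definition limit_law :: "scaling \<Rightarrow> weighting \<Rightarrow> limit_params \<Rightarrow> ereal \<Rightarrow> real measure" where
  "limit_law v w p c =
     distr (joint_law p c) borel
       (\<lambda>(a\<^sub>1, a\<^sub>2).
          weighted_stat v w p
            (\<lambda>t. if t = 1 then pilot_prob p else followup_prob p c a\<^sub>1)
            (\<lambda>t. if t = 1 then a\<^sub>1 else a\<^sub>2))"

end

theory Submission
  imports Defs
begin

text \<open>
Letting $c \to -\infty$ only changes the follow-up probabilities, and these converge pointwise. This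
becomes convergence in Wasserstein distance once the limit laws for all $c$ are realised on one
probability space on which the statistics converge pointwise and are dominated.

The common space carries two independent standard normal vectors $Z, Z'$ in the plane. The pilot
vector is a fixed linear image of $Z$, and given the pilot vector $a$ the follow-up vector is
$R(\rho_c(a)) Z'$, where $\rho_c(a)$ is the limiting covariance and $R(\rho)$ is the Cholesky factor of the
correlation matrix with off-diagonal entry $\rho$. That this has the prescribed joint law is the change
of variables formula for normal densities (\<open>centered_normal_eq_distr\<close>), combined with a general
fact on kernels that are driven by independent noise (\<open>bind_distr_kernel_eq_distr_pair\<close>). It needs
covariance matrices that are nonsingular, $|\rho_c(a)| < 1$, which follows from the positive variances
of the potential outcomes and from the fact that the two allocation probabilities add up to one
(\<open>abs_lim_cov_less_1\<close>).

For fixed $a$ the pilot statistic tends to $-\infty$ with $c$. Both kinds of sampling functions are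
continuous at $-\infty$: Lipschitz designs by hypothesis, step functions because they are constant
near $-\infty$. Hence the follow-up probabilities, the covariances, the weights and finally the
statistic converge for every value of the noise. The statistics are bounded by a constant multiple
of the sum of the absolute values of the noise coordinates (\<open>abs_coupled_stat_le\<close>): after
normalization each weight is at most one, and before normalization the weights are bounded, thanks to
the positive clipping level in the constant regime and to the pilot part of the denominator in the
adaptive regime. Dominated convergence then shows that the mean distance of the coupled statistics
tends to zero, and this mean distance is an upper bound for the Wasserstein distance
(\<open>wasserstein1_distr_le\<close>).
\<close>

section \<open>Couplings bound the 1-Wasserstein distance\<close>

lemma wasserstein1_nonneg: "0 \<le> wasserstein1 \<mu> \<nu>"
proof -
  have "1-lipschitz_on UNIV (\<lambda>x :: real. 0 :: real)"
    by (simp add: lipschitz_on_def)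
  then show ?thesis
    unfolding wasserstein1_def by (intro SUP_upper2[of "\<lambda>_. 0"]) auto
qed

text \<open>
A common probability space for the two variables is a transport plan, and a 1-Lipschitz test
function cannot separate them by more than their distance at each point.
\<close>

lemma wasserstein1_distr_le:
  fixes X Y :: "'a \<Rightarrow> real"
  assumes "prob_space M" and X: "integrable M X" and Y: "integrable M Y"
  shows "wasserstein1 (distr M borel X) (distr M borel Y) \<le> ereal (\<integral>x. \<bar>X x - Y x\<bar> \<partial>M)"
  unfolding wasserstein1_def
proof (rule SUP_least, safe)
  fix f :: "real \<Rightarrow> real"
  assume f: "1-lipschitz_on UNIV f"
  interpret prob_space M by fact
  have [measurable]: "f \<in> borel_measurable borel"
    using f by (intro borel_measurable_continuous_onI lipschitz_on_continuous_on)
  have lip: "\<bar>f x - f y\<bar> \<le> \<bar>x - y\<bar>" for x y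
    using lipschitz_onD[OF f, of x y] by (simp add: dist_real_def)
  have int: "integrable M (\<lambda>x. f (Z x))" if Z: "integrable M Z" for Z
  proof (rule Bochner_Integration.integrable_bound)
    show "integrable M (\<lambda>x. \<bar>f 0\<bar> + \<bar>Z x\<bar>)"
      using Z by simp
    show "(\<lambda>x. f (Z x)) \<in> borel_measurable M"
      using Z by measurable
    show "AE x in M. norm (f (Z x)) \<le> norm (\<bar>f 0\<bar> + \<bar>Z x\<bar>)"
    proof (rule AE_I2)
      fix x show "norm (f (Z x)) \<le> norm (\<bar>f 0\<bar> + \<bar>Z x\<bar>)"
        using lip[of "Z x" 0] by simp
    qed
  qed
  have "(\<integral>x. f x \<partial>distr M borel X) - (\<integral>x. f x \<partial>distr M borel Y) = (\<integral>x. f (X x) - f (Y x) \<partial>M)"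
    using X Y int[OF X] int[OF Y] by (simp add: integral_distr)
  moreover have "\<bar>\<integral>x. f (X x) - f (Y x) \<partial>M\<bar> \<le> (\<integral>x. \<bar>f (X x) - f (Y x)\<bar> \<partial>M)"
    by (rule integral_abs_bound)
  moreover have "\<dots> \<le> (\<integral>x. \<bar>X x - Y x\<bar> \<partial>M)"
    using X Y int[OF X] int[OF Y] by (intro integral_mono) (auto intro: lip)
  ultimately have "\<bar>(\<integral>x. f x \<partial>distr M borel X) - (\<integral>x. f x \<partial>distr M borel Y)\<bar>
      \<le> (\<integral>x. \<bar>X x - Y x\<bar> \<partial>M)"
    by linarith
  then show "ereal \<bar>(\<integral>x. f x \<partial>distr M borel X) - (\<integral>x. f x \<partial>distr M borel Y)\<bar>
      \<le> ereal (\<integral>x. \<bar>X x - Y x\<bar> \<partial>M)"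
    by simp
qed

section \<open>Linear images of the standard normal law\<close>

lemma measurable_matrix_vector_mult [measurable]:
  fixes A :: "real ^ 'n ^ 'm"
  shows "(*v) A \<in> borel \<rightarrow>\<^sub>M borel"
  by (intro borel_measurable_continuous_onI linear_continuous_on matrix_vector_mul_bounded_linear)

text \<open>
Linear change of variables for Lebesgue measure as an identity of measures; it suffices to compare
the two sides on boxes, whose preimages are images of boxes under the inverse matrix. The index type
is well-ordered as in \<open>measure_linear_image\<close>, which computes the volumes.
\<close>

lemma lborel_eq_density_distr_matrix:
  fixes A :: "real ^ 'n :: {finite, wellorder} ^ 'n :: _"
  assumes "det A \<noteq> 0"
  shows "lborel = density (distr lborel borel ((*v) A)) (\<lambda>_. ennreal \<bar>det A\<bar>)"
proof (rule lborel_eqI)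
  obtain B where inv: "A ** B = mat 1" "B ** A = mat 1"
    using assms by (auto simp: invertible_det_nz[symmetric] invertible_def)
  have det: "det A * det B = 1"
    by (metis inv(1) det_mul det_I)
  fix l u :: "real ^ 'n :: _"
  assume le: "\<And>b. b \<in> Basis \<Longrightarrow> l \<bullet> b \<le> u \<bullet> b"
  have vimage: "(*v) A -` box l u = (*v) B ` box l u"
  proof (safe)
    fix x assume "A *v x \<in> box l u"
    moreover have "x = B *v (A *v x)"
      by (simp add: matrix_vector_mul_assoc inv)
    ultimately show "x \<in> (*v) B ` box l u" by blast
  qed (simp add: matrix_vector_mul_assoc inv)
  have lin: "linear ((*v) B)" by simp
  have lm: "(*v) B ` box l u \<in> lmeasurable"
    by (rule measurable_linear_image[OF lin]) simp
  have borel: "(*v) A -` box l u \<in> sets borel"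
    using measurable_sets[OF measurable_matrix_vector_mult, of "box l u" A] by simp
  have "emeasure lborel ((*v) A -` box l u) = emeasure lebesgue ((*v) B ` box l u)"
    unfolding vimage[symmetric] using borel by simp
  also have "\<dots> = ennreal (measure lebesgue ((*v) B ` box l u))"
    by (rule emeasure_eq_ennreal_measure) (rule fmeasurableD2[OF lm])
  also have "\<dots> = ennreal (\<bar>det B\<bar> * (\<Prod>b\<in>Basis. (u - l) \<bullet> b))"
    using le by (subst measure_linear_image[OF lin]) (simp_all add: measure_lborel_box_eq)
  finally have *: "emeasure lborel ((*v) A -` box l u) = \<dots>" .
  have "emeasure (density (distr lborel borel ((*v) A)) (\<lambda>_. ennreal \<bar>det A\<bar>)) (box l u)
      = ennreal \<bar>det A\<bar> * emeasure lborel ((*v) A -` box l u)"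
    by (simp add: emeasure_density_const emeasure_distr)
  also have "\<dots> = ennreal (\<bar>det A * det B\<bar> * (\<Prod>b\<in>Basis. (u - l) \<bullet> b))"
    unfolding * by (simp add: abs_mult ac_simps flip: ennreal_mult')
  also have "\<dots> = (\<Prod>b\<in>Basis. (u - l) \<bullet> b)"
    by (simp add: det)
  finally show "emeasure (density (distr lborel borel ((*v) A)) (\<lambda>_. ennreal \<bar>det A\<bar>)) (box l u)
      = (\<Prod>b\<in>Basis. (u - l) \<bullet> b)" .
qed simp

lemma matrix_inv_eqI:
  fixes A :: "real ^ 'n ^ 'n"
  assumes "A ** B = mat 1"
  shows "matrix_inv A = B"
proof -
  have "\<exists>A'. A ** A' = mat 1 \<and> A' ** A = mat 1"
    using assms by (metis matrix_left_right_inverse)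
  from someI_ex[OF this] have "matrix_inv A ** A = mat 1"
    by (simp add: matrix_inv_def)
  then show ?thesis
    using assms matrix_mul_assoc[of "matrix_inv A" A B] by simp
qed

text \<open>
This realises every nondegenerate normal law as a fixed linear function of one and the same noise, so that
normal laws with different covariance matrices can be put on a common probability space.
\<close>

lemma centered_normal_eq_distr:
  fixes A :: "real ^ 'n :: {finite, wellorder} ^ 'n :: _"
  assumes "det A \<noteq> 0"
  shows "centered_normal (A ** transpose A) = distr (centered_normal (mat 1)) borel ((*v) A)"
proof -
  define \<phi> where "\<phi> z = exp (- (z \<bullet> z) / 2) / sqrt ((2 * pi) ^ CARD('n))" for z :: "real ^ 'n :: _"
  have meas [measurable]: "\<phi> \<in> borel_measurable borel"
    unfolding \<phi>_def by measurable
  obtain B where inv: "A ** B = mat 1" "B ** A = mat 1"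
    using assms by (auto simp: invertible_det_nz[symmetric] invertible_def)
  have Sigma_inv: "matrix_inv (A ** transpose A) = transpose B ** B"
  proof (rule matrix_inv_eqI)
    have "(A ** transpose A) ** (transpose B ** B) = A ** (transpose (B ** A)) ** B"
      by (simp add: matrix_transpose_mul matrix_mul_assoc)
    then show "(A ** transpose A) ** (transpose B ** B) = mat 1"
      by (simp add: inv)
  qed
  have density: "exp (- (x \<bullet> (matrix_inv (A ** transpose A) *v x)) / 2)
      / sqrt ((2 * pi) ^ CARD('n) * det (A ** transpose A)) = \<phi> (B *v x) / \<bar>det A\<bar>" for x
  proof -
    have "x \<bullet> (matrix_inv (A ** transpose A) *v x) = (B *v x) \<bullet> (B *v x)"
      unfolding Sigma_inv matrix_vector_mul_assoc[symmetric] dot_lmul_matrix[symmetric]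
      by (simp add: vector_transpose_matrix)
    moreover have "sqrt ((2 * pi) ^ CARD('n) * det (A ** transpose A))
        = sqrt ((2 * pi) ^ CARD('n)) * \<bar>det A\<bar>"
      by (simp add: det_mul real_sqrt_mult)
    ultimately show ?thesis by (simp add: \<phi>_def)
  qed
  have std: "centered_normal (mat 1 :: real ^ 'n :: _ ^ 'n :: _)
      = density lborel (\<lambda>z. ennreal (\<phi> (B *v (A *v z))))"
    by (simp add: centered_normal_def matrix_inv_eqI[OF matrix_mul_lid] \<phi>_def matrix_vector_mul_assoc inv)
  have "distr (centered_normal (mat 1)) borel ((*v) A)
      = density (distr lborel borel ((*v) A)) (\<lambda>x. ennreal (\<phi> (B *v x)))"
    unfolding std by (subst density_distr) simp_all
  also have "\<dots> = density (distr lborel borel ((*v) A))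
      (\<lambda>x. ennreal \<bar>det A\<bar> * ennreal (\<phi> (B *v x) / \<bar>det A\<bar>))"
    using assms by (intro arg_cong2[where f = density] refl ext) (simp flip: ennreal_mult')
  also have "\<dots> = density lborel (\<lambda>x. ennreal (\<phi> (B *v x) / \<bar>det A\<bar>))"
    by (subst (2) lborel_eq_density_distr_matrix[OF assms], subst density_density_eq) simp_all
  also have "\<dots> = centered_normal (A ** transpose A)"
    unfolding centered_normal_def density ..
  finally show ?thesis ..
qed

text \<open>
In this form the integrals of products of functions of single coordinates factor into
one-dimensional integrals.
\<close>

lemma centered_normal_mat_1:
  "centered_normal (mat 1 :: real ^ 'n ^ 'n) =
     density lborel (\<lambda>x. \<Prod>b\<in>Basis. ennreal (std_normal_density (x \<bullet> b)))"
proof -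
  have "exp (- (x \<bullet> x) / 2) / sqrt ((2 * pi) ^ CARD('n)) = (\<Prod>b\<in>Basis. std_normal_density (x \<bullet> b))"
    for x :: "real ^ 'n"
  proof -
    have "(\<Prod>b\<in>Basis. std_normal_density (x \<bullet> b))
        = exp (\<Sum>b\<in>Basis. - (x \<bullet> b)\<^sup>2 / 2) / sqrt (2 * pi) ^ CARD('n)"
      by (simp add: std_normal_density_def prod_dividef exp_sum field_simps)
    also have "(\<Sum>b\<in>Basis. - (x \<bullet> b)\<^sup>2 / 2) = - (x \<bullet> x) / 2"
      by (simp add: euclidean_inner[of x x] sum_negf power2_eq_square flip: sum_divide_distrib)
    finally show ?thesis by (simp add: real_sqrt_power[symmetric] del: power_mult_distrib)
  qed
  then show ?thesis
    by (simp add: centered_normal_def matrix_inv_eqI[OF matrix_mul_lid] prod_ennreal)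
qed

lemma prob_space_standard_normal: "prob_space (centered_normal (mat 1 :: real ^ 'n ^ 'n))"
proof
  have "emeasure (centered_normal (mat 1 :: real ^ 'n ^ 'n)) UNIV
      = (\<integral>\<^sup>+x. (\<Prod>b\<in>Basis. ennreal (std_normal_density (x \<bullet> b)))
          \<partial>(lborel :: (real ^ 'n) measure))"
    unfolding centered_normal_mat_1 by (simp add: emeasure_density)
  also have "\<dots> = (\<Prod>b\<in>(Basis :: (real ^ 'n) set). \<integral>\<^sup>+t. ennreal (std_normal_density t) \<partial>lborel)"
    by (rule nn_integral_lborel_prod) simp_all
  also have "(\<integral>\<^sup>+t. ennreal (std_normal_density t) \<partial>lborel) = 1"
    by (simp add: nn_integral_eq_integral)
  finally show "emeasure (centered_normal (mat 1 :: real ^ 'n ^ 'n))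
      (space (centered_normal (mat 1 :: real ^ 'n ^ 'n))) = 1"
    by (simp add: centered_normal_def)
qed

lemma integrable_standard_normal_inner:
  fixes b :: "real ^ 'n"
  assumes b: "b \<in> Basis"
  shows "integrable (centered_normal (mat 1)) (\<lambda>x. x \<bullet> b)"
proof (rule integrableI_bounded)
  \<comment> \<open>Multiplying the density by this product leaves a product over the coordinates.\<close>
  define m where "m i t = (if i = b then \<bar>t\<bar> else 1)" for i and t :: real
  have "(\<integral>\<^sup>+x. ennreal (norm (x \<bullet> b)) \<partial>centered_normal (mat 1))
      = (\<integral>\<^sup>+x. (\<Prod>i\<in>Basis. ennreal (std_normal_density (x \<bullet> i) * m i (x \<bullet> i))) \<partial>lborel)"
  proof -
    have "(\<Prod>i\<in>Basis. ennreal (std_normal_density (x \<bullet> i) * m i (x \<bullet> i)))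
        = (\<Prod>i\<in>Basis. ennreal (std_normal_density (x \<bullet> i))) * ennreal (norm (x \<bullet> b))" for x
    proof -
      have "(\<Prod>i\<in>Basis. m i (x \<bullet> i)) = \<bar>x \<bullet> b\<bar>"
        using b by (simp add: m_def prod.delta')
      then show ?thesis
        by (simp add: prod_ennreal m_def prod.distrib prod_nonneg flip: ennreal_mult')
    qed
    then show ?thesis
      unfolding centered_normal_mat_1 by (subst nn_integral_density) simp_all
  qed
  also have "\<dots> = (\<Prod>i\<in>Basis. \<integral>\<^sup>+t. ennreal (std_normal_density t * m i t) \<partial>lborel)"
    by (rule nn_integral_lborel_prod) (simp_all add: m_def)
  also have "\<dots> < \<infinity>"
  proof -
    have "integrable lborel (\<lambda>t. std_normal_density t * m i t)" for i :: "real ^ 'n"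
      using integrable_std_normal_moment_abs[of 1] integrable_std_normal_moment[of 0]
      by (cases "i = b") (simp_all add: m_def)
    then have "(\<integral>\<^sup>+t. ennreal (std_normal_density t * m i t) \<partial>lborel) < \<infinity>" for i :: "real ^ 'n"
      by (subst nn_integral_eq_integral) (auto simp: m_def)
    then show ?thesis
      by (induction rule: infinite_finite_induct[of _ Basis]) (simp_all add: ennreal_mult_less_top)
  qed
  finally show "(\<integral>\<^sup>+x. ennreal (norm (x \<bullet> b)) \<partial>centered_normal (mat 1)) < \<infinity>" .
qed (simp add: centered_normal_def)

section \<open>Hierarchical sampling as a function of independent noise\<close>

lemma sets_centered_normal [simp, measurable_cong]: "sets (centered_normal \<Sigma>) = sets borel"
  by (simp add: centered_normal_def)

lemma space_centered_normal [simp]: "space (centered_normal \<Sigma>) = UNIV"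
  by (simp add: centered_normal_def)

text \<open>
A two-step random experiment, in which the law of the second outcome depends on the first one, is
driven by two independent copies of the noise once the kernel itself is presented as a function
\<open>G\<close> of the first outcome and fresh noise.
\<close>

lemma bind_distr_kernel_eq_distr_pair:
  fixes F :: "'z :: second_countable_topology \<Rightarrow> 'a :: second_countable_topology"
    and G :: "'a \<Rightarrow> 'z \<Rightarrow> 'b :: second_countable_topology"
  assumes Z: "prob_space Z" and sets_Z [measurable_cong]: "sets Z = sets borel"
    and F [measurable]: "F \<in> borel_measurable borel"
    and G [measurable]: "case_prod G \<in> borel_measurable (borel \<Otimes>\<^sub>M borel)"
  shows "distr Z borel F \<bind> (\<lambda>a. distr Z borel (G a) \<bind> (\<lambda>b. return borel (a, b)))
       = distr (Z \<Otimes>\<^sub>M Z) borel (\<lambda>(z, z'). (F z, G (F z) z'))"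
proof -
  interpret Z: prob_space Z by fact
  interpret pair_prob_space Z Z ..
  define J where "J a = distr Z borel (\<lambda>z'. (a, G a z'))" for a
  have Z_alg: "Z \<in> space (subprob_algebra Z)"
    by (simp add: space_subprob_algebra Z.subprob_space_axioms)
  have meas_G: "G a \<in> borel_measurable borel" for a
    using measurable_compose_Pair1[of a borel "case_prod G" borel borel] G by simp
  have pair [measurable]: "(\<lambda>(a, z'). (a, G a z')) \<in> borel \<Otimes>\<^sub>M borel \<rightarrow>\<^sub>M borel"
    unfolding borel_prod[symmetric] by measurable
  have kernel: "distr Z borel (G a) \<bind> (\<lambda>b. return borel (a, b)) = J a" for a
    unfolding J_def using meas_G[of a]
    by (intro bind_distr_return) (auto simp: sets_Z Z.not_empty cong: measurable_cong_sets)
  have J: "J \<in> borel \<rightarrow>\<^sub>M subprob_algebra borel"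
    unfolding J_def
    by (rule measurable_distr2[where M = Z]) (auto intro: measurable_const Z_alg)
  have H: "(\<lambda>(z, z'). (F z, G (F z) z')) \<in> Z \<Otimes>\<^sub>M Z \<rightarrow>\<^sub>M borel"
    unfolding borel_prod[symmetric] by measurable
  have "distr Z borel F \<bind> J = Z \<bind> (\<lambda>z. J (F z))"
    by (rule bind_distr) (use J in \<open>simp_all add: Z.not_empty\<close>)
  also have "\<dots> = Z \<bind> (\<lambda>z. distr (distr Z (Z \<Otimes>\<^sub>M Z) (Pair z)) borel (\<lambda>(z, z'). (F z, G (F z) z')))"
  proof (rule bind_cong[OF refl])
    fix z assume z: "z \<in> space Z"
    show "J (F z) = distr (distr Z (Z \<Otimes>\<^sub>M Z) (Pair z)) borel (\<lambda>(z, z'). (F z, G (F z) z'))"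
      unfolding J_def using z by (subst distr_distr[OF H]) (simp_all add: comp_def)
  qed
  also have "\<dots> = Z \<bind> (\<lambda>z. distr (Z \<bind> (\<lambda>z'. return (Z \<Otimes>\<^sub>M Z) (z, z'))) borel
      (\<lambda>(z, z'). (F z, G (F z) z')))"
    by (intro bind_cong[OF refl]) (simp add: bind_return_distr' Z.not_empty)
  also have "\<dots> = distr (Z \<bind> (\<lambda>z. Z \<bind> (\<lambda>z'. return (Z \<Otimes>\<^sub>M Z) (z, z')))) borel
      (\<lambda>(z, z'). (F z, G (F z) z'))"
  proof (rule distr_bind[symmetric])
    show "(\<lambda>z. Z \<bind> (\<lambda>z'. return (Z \<Otimes>\<^sub>M Z) (z, z'))) \<in> Z \<rightarrow>\<^sub>M subprob_algebra (Z \<Otimes>\<^sub>M Z)"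
      by (rule measurable_bind[where N = Z]) (auto intro: measurable_const Z_alg)
  qed (use H in \<open>simp_all add: Z.not_empty\<close>)
  finally show ?thesis
    by (simp only: kernel flip: pair_measure_eq_bind)
qed

section \<open>Cholesky factors of 2 by 2 correlation matrices\<close>

text \<open>
The lower triangular square root of the correlation matrix with off-diagonal entry \<open>r\<close>. Its entries
depend continuously on \<open>r\<close>, which makes the coupling below continuous in the covariances.
\<close>

definition cholesky :: "real \<Rightarrow> real ^ 2 ^ 2" where
  "cholesky r = (\<chi> i j. if j = 0 then (if i = 0 then 1 else r)
                       else (if i = 0 then 0 else sqrt (1 - r\<^sup>2)))"

text \<open>
The numeral \<open>2\<close> of the two-element type names the arm 0; the library facts on this type enumerate its
elements as 1 and 2.
\<close>

lemma two_eq_zero: "(2 :: 2) = 0"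
  by simp

lemma sum_arms: "sum f (UNIV :: 2 set) = f 0 + f 1"
  by (simp add: sum_2 two_eq_zero add.commute)

lemma all_arms: "(\<forall>s :: 2. Q s) \<longleftrightarrow> Q 0 \<and> Q 1"
  by (auto simp: forall_2 two_eq_zero)

lemma det_cholesky: "det (cholesky r) = sqrt (1 - r\<^sup>2)"
  by (simp add: det_2 cholesky_def)

lemma cholesky_mult:
  "(cholesky r *v z) $ 0 = z $ 0" "(cholesky r *v z) $ 1 = r * z $ 0 + sqrt (1 - r\<^sup>2) * z $ 1"
  by (simp_all add: matrix_vector_mult_def sum_arms cholesky_def)

lemma cholesky_square:
  assumes "\<bar>r\<bar> \<le> 1"
  shows "cholesky r ** transpose (cholesky r) = (\<chi> i j. if i = j then 1 else r)"
proof -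
  have "r\<^sup>2 \<le> 1" using assms by (simp add: abs_square_le_1)
  then show ?thesis
    by (auto simp: vec_eq_iff all_arms matrix_matrix_mult_def transpose_def sum_arms cholesky_def
        power2_eq_square)
qed

text \<open>
A bound by the noise that is uniform over all correlations, for the sake of dominated convergence.
\<close>

lemma abs_cholesky_mult_le:
  assumes "\<bar>r\<bar> \<le> 1"
  shows "\<bar>(cholesky r *v z) $ i\<bar> \<le> \<bar>z $ 0\<bar> + \<bar>z $ 1\<bar>"
proof -
  have "r\<^sup>2 \<le> 1" using assms by (simp add: abs_square_le_1)
  then have s: "\<bar>sqrt (1 - r\<^sup>2)\<bar> \<le> 1" by simp
  have "\<bar>r * z $ 0\<bar> \<le> \<bar>z $ 0\<bar>" "\<bar>sqrt (1 - r\<^sup>2) * z $ 1\<bar> \<le> \<bar>z $ 1\<bar>"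
    unfolding abs_mult using assms s by (auto intro: mult_left_le_one_le)
  then have "\<bar>(cholesky r *v z) $ 1\<bar> \<le> \<bar>z $ 0\<bar> + \<bar>z $ 1\<bar>"
    unfolding cholesky_mult by linarith
  then have "\<forall>i. \<bar>(cholesky r *v z) $ i\<bar> \<le> \<bar>z $ 0\<bar> + \<bar>z $ 1\<bar>"
    by (simp add: all_arms cholesky_mult)
  then show ?thesis ..
qed

lemma borel_measurable_vec_nth [measurable]: "(\<lambda>x :: real ^ 'n. x $ i) \<in> borel_measurable borel"
  by (intro borel_measurable_continuous_onI continuous_on_component continuous_on_id)

lemma borel_measurable_vec:
  fixes f :: "'a \<Rightarrow> real ^ 'n"
  assumes "\<And>i. (\<lambda>x. f x $ i) \<in> borel_measurable M"
  shows "f \<in> borel_measurable M"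
proof (subst borel_measurable_euclidean_space, rule)
  fix b :: "real ^ 'n" assume "b \<in> Basis"
  then obtain i where "b = axis i 1"
    by (auto simp: Basis_vec_def)
  then show "(\<lambda>x. f x \<bullet> b) \<in> borel_measurable M"
    using assms[of i] by (simp add: inner_axis)
qed

lemma measurable_cholesky_mult [measurable (raw)]:
  assumes [measurable]: "r \<in> borel_measurable M" "f \<in> borel_measurable M"
  shows "(\<lambda>x. cholesky (r x) *v f x) \<in> borel_measurable M"
proof (rule borel_measurable_vec)
  have "\<forall>i. (\<lambda>x. (cholesky (r x) *v f x) $ i) \<in> borel_measurable M"
    by (simp add: all_arms cholesky_mult)
  then show "(\<lambda>x. (cholesky (r x) *v f x) $ i) \<in> borel_measurable M" for i ..
qed

section \<open>The limit experiment\<close>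

text \<open>
What the limit laws retain of the experiment. The strict inequality between the moments is the
positive variance of the potential outcomes; measurability and continuity at minus infinity are the
properties that Lipschitz designs and step functions share.
\<close>

locale limit_setting =
  fixes p :: limit_params and w :: weighting
  assumes stage_prop_pos: "0 < stage_prop p 1" "0 < stage_prop p 2"
    and stage_prop_sum: "stage_prop p 1 + stage_prop p 2 = 1"
    and pilot_prob_pos: "0 < pilot_prob p s"
    and pilot_prob_sum: "pilot_prob p 0 + pilot_prob p 1 = 1"
    and second_moment_gt: "(lim_mean p s)\<^sup>2 < lim_second p s"
    and lim_clip_nonneg: "0 \<le> lim_clip p"
    and lim_clip_le: "lim_clip p \<le> 1 / 2"
    and lim_clip_pos: "w = Constant \<Longrightarrow> 0 < lim_clip p"
    and sampling_sum: "x \<in> rbar \<Longrightarrow> sampling p 0 x + sampling p 1 x = 1"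
    and measurable_sampling [measurable]: "(\<lambda>x. sampling p s (ereal x)) \<in> borel_measurable borel"
    and sampling_tendsto: "(sampling p s \<longlongrightarrow> sampling p s (-\<infinity>)) (at (-\<infinity>) within rbar)"
begin

text \<open>
The values that the vector of follow-up probabilities can take after clipping.
\<close>

definition allocations :: "(2 \<Rightarrow> real) set" where
  "allocations = {h. h 0 + h 1 = 1 \<and> (\<forall>s. 0 \<le> h s \<and> lim_clip p \<le> h s)}"

text \<open>
A bound on the weights that is uniform over all allocations. Under adaptive weighting the share of
the pilot stage keeps the denominator of a weight away from zero; under constant weighting the
positive clipping level does so at the follow-up stage.
\<close>

definition weight_bound :: "2 \<Rightarrow> real" where
  "weight_bound s = (case w of
     Adaptive \<Rightarrow> sqrt (lim_second p s) / (stage_prop p 1 * sqrt (pilot_prob p s))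
   | Constant \<Rightarrow> sqrt (lim_second p s / min (pilot_prob p s) (lim_clip p)))"

lemma pilot_prob_split: "pilot_prob p 0 + pilot_prob p 1 = 1 \<and> (\<forall>s. 0 \<le> pilot_prob p s)"
  using pilot_prob_sum pilot_prob_pos by (auto intro: less_imp_le)

text \<open>
An allocation probability lies between zero and one, so the asymptotic variance lies between the
variance of the potential outcome, which is positive, and its second moment.
\<close>

lemma lim_var_bounds:
  assumes "h 0 + h 1 = 1" "\<forall>s. 0 \<le> h s"
  shows "0 < lim_var p h s" "lim_var p h s \<le> lim_second p s"
proof -
  have "\<forall>s. h s \<le> 1"
    using assms by (simp add: all_arms)
  then have "h s * (lim_mean p s)\<^sup>2 \<le> (lim_mean p s)\<^sup>2"
    using assms by (simp add: mult_left_le_one_le)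
  then show "0 < lim_var p h s" "lim_var p h s \<le> lim_second p s"
    using second_moment_gt[of s] assms(2) by (simp_all add: lim_var_def)
qed

text \<open>
The limiting covariance matrices are positive definite: as the two probabilities add up to one, the
variance of either arm exceeds its squared mean times the probability of the other arm, and the
product of these two inequalities is the claim.
\<close>

lemma abs_lim_cov_less_1:
  assumes h: "h 0 + h 1 = 1" "\<forall>s. 0 \<le> h s"
  shows "\<bar>lim_cov p h\<bar> < 1"
proof -
  have V: "0 < lim_var p h s" for s
    using lim_var_bounds[OF h] by simp
  have gt: "h 1 * (lim_mean p 0)\<^sup>2 < lim_var p h 0" "h 0 * (lim_mean p 1)\<^sup>2 < lim_var p h 1"
  proof -
    have "h 0 * (lim_mean p 0)\<^sup>2 + h 1 * (lim_mean p 0)\<^sup>2 = (lim_mean p 0)\<^sup>2"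
      "h 0 * (lim_mean p 1)\<^sup>2 + h 1 * (lim_mean p 1)\<^sup>2 = (lim_mean p 1)\<^sup>2"
      using h(1) by (simp_all flip: distrib_right)
    then show "h 1 * (lim_mean p 0)\<^sup>2 < lim_var p h 0" "h 0 * (lim_mean p 1)\<^sup>2 < lim_var p h 1"
      unfolding lim_var_def using second_moment_gt[of 0] second_moment_gt[of 1] by linarith+
  qed
  have "(lim_cov p h)\<^sup>2 = (h 1 * (lim_mean p 0)\<^sup>2) * (h 0 * (lim_mean p 1)\<^sup>2)
      / (lim_var p h 0 * lim_var p h 1)"
    using h(2) V[of 0] V[of 1] by (simp add: lim_cov_def power_mult_distrib)
  also have "\<dots> < 1"
    using mult_strict_mono'[OF gt] h(2) V[of 0] V[of 1] by simp
  finally show ?thesis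
    by (simp add: abs_square_less_1)
qed

lemma centered_normal_lim_Sigma:
  assumes "h 0 + h 1 = 1" "\<forall>s. 0 \<le> h s"
  shows "centered_normal (lim_Sigma p h)
       = distr (centered_normal (mat 1)) borel ((*v) (cholesky (lim_cov p h)))"
proof -
  have r: "\<bar>lim_cov p h\<bar> < 1"
    using assms by (rule abs_lim_cov_less_1)
  then have "(lim_cov p h)\<^sup>2 < 1"
    by (simp add: abs_square_less_1)
  then have "det (cholesky (lim_cov p h)) \<noteq> 0"
    by (simp add: det_cholesky)
  moreover have "lim_Sigma p h = cholesky (lim_cov p h) ** transpose (cholesky (lim_cov p h))"
    using r by (simp add: cholesky_square lim_Sigma_def)
  ultimately show ?thesis
    by (simp add: centered_normal_eq_distr)
qed

lemma lim_pilot_stat_MInfty: "lim_pilot_stat p (-\<infinity>) a = -\<infinity>"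
  using stage_prop_pos by (simp add: lim_pilot_stat_def)

lemma lim_pilot_stat_real: "lim_pilot_stat p (ereal c) a =
   ereal (a $ 0 * sqrt (lim_var p (pilot_prob p) 0 / pilot_prob p 0)
        - a $ 1 * sqrt (lim_var p (pilot_prob p) 1 / pilot_prob p 1) + sqrt (stage_prop p 1) * c)"
  by (simp add: lim_pilot_stat_def)

lemma lim_pilot_stat_rbar: "c \<le> 0 \<Longrightarrow> lim_pilot_stat p c a \<in> rbar"
  by (cases c) (simp_all add: lim_pilot_stat_MInfty lim_pilot_stat_real rbar_def)

lemma followup_prob_split:
  assumes "c \<le> 0"
  shows "followup_prob p c a 0 + followup_prob p c a 1 = 1"
    and "lim_clip p \<le> followup_prob p c a s"
    and "\<forall>s. 0 \<le> followup_prob p c a s"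
proof -
  show "followup_prob p c a 0 + followup_prob p c a 1 = 1"
    using sampling_sum[OF lim_pilot_stat_rbar[OF assms, of a]] lim_clip_le
    unfolding followup_prob_def by (auto simp: min_def max_def)
  have *: "lim_clip p \<le> followup_prob p c a s" for s
    using lim_clip_le unfolding followup_prob_def by (auto simp: min_def max_def)
  show "lim_clip p \<le> followup_prob p c a s" by (rule *)
  show "\<forall>s. 0 \<le> followup_prob p c a s"
    using * lim_clip_nonneg by (blast intro: order_trans)
qed

lemma measurable_followup_prob:
  assumes "c \<le> 0"
  shows "(\<lambda>a. followup_prob p c a s) \<in> borel_measurable borel"
proof (cases c)
  case (real r)
  then show ?thesis
    unfolding followup_prob_def real lim_pilot_stat_real by measurable
qed (use assms in \<open>simp_all add: followup_prob_def lim_pilot_stat_MInfty\<close>)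

text \<open>
For a fixed pilot outcome the pilot statistic drifts to minus infinity along with \<open>c\<close>, and the
sampling function is continuous there.
\<close>

lemma tendsto_followup_prob:
  "((\<lambda>c. followup_prob p c a s) \<longlongrightarrow> followup_prob p (-\<infinity>) a s) (at (-\<infinity>) within {..0})"
proof -
  have "((\<lambda>c. lim_pilot_stat p c a) \<longlongrightarrow> lim_pilot_stat p (-\<infinity>) a) (at (-\<infinity>) within {..0})"
    unfolding lim_pilot_stat_def using stage_prop_pos by (intro tendsto_intros) auto
  moreover have "eventually (\<lambda>c. lim_pilot_stat p c a \<in> rbar \<and> lim_pilot_stat p c a \<noteq> -\<infinity>)
      (at (-\<infinity>) within {..0})"
    unfolding eventually_at_filter
  proof (intro always_eventually allI impI)
    fix c :: ereal assume "c \<noteq> -\<infinity>" "c \<in> {..0}"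
    then show "lim_pilot_stat p c a \<in> rbar \<and> lim_pilot_stat p c a \<noteq> -\<infinity>"
      by (cases c) (simp_all add: lim_pilot_stat_real rbar_def)
  qed
  ultimately have "filterlim (\<lambda>c. lim_pilot_stat p c a) (at (-\<infinity>) within rbar) (at (-\<infinity>) within {..0})"
    by (simp add: filterlim_at lim_pilot_stat_MInfty)
  then have "((\<lambda>c. sampling p s (lim_pilot_stat p c a)) \<longlongrightarrow> sampling p s (-\<infinity>)) (at (-\<infinity>) within {..0})"
    by (rule filterlim_compose[OF sampling_tendsto])
  then show ?thesis
    unfolding followup_prob_def lim_pilot_stat_MInfty by (intro tendsto_intros)
qed

section \<open>The coupled limit statistics\<close>

text \<open>
The two Gaussian vectors as functions of standard normal noise; the noise is the same for all \<open>c\<close>,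
and this is the coupling of the limit laws.
\<close>

definition pilot_vec :: "real ^ 2 \<Rightarrow> real ^ 2" where
  "pilot_vec z = cholesky (lim_cov p (pilot_prob p)) *v z"

definition followup_vec :: "ereal \<Rightarrow> real ^ 2 \<Rightarrow> real ^ 2 \<Rightarrow> real ^ 2" where
  "followup_vec c a z = cholesky (lim_cov p (followup_prob p c a)) *v z"

definition stat :: "scaling \<Rightarrow> (2 \<Rightarrow> real) \<Rightarrow> real ^ 2 \<Rightarrow> real ^ 2 \<Rightarrow> real" where
  "stat v h a\<^sub>1 a\<^sub>2 = weighted_stat v w p (\<lambda>t. if t = 1 then pilot_prob p else h)
     (\<lambda>t. if t = 1 then a\<^sub>1 else a\<^sub>2)"

definition arm_weight :: "(2 \<Rightarrow> real) \<Rightarrow> nat \<Rightarrow> 2 \<Rightarrow> real" where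
  "arm_weight h t s = weight w p (\<lambda>t. if t = 1 then pilot_prob p else h) t s"

lemma sum_stages: "(\<Sum>t=1..2. f t) = f 1 + f (2 :: nat)"
  by (simp add: numeral_2_eq_2)

lemma arm_weight_Adaptive:
  assumes "w = Adaptive"
  shows "arm_weight h t s = sqrt (stage_prop p t * lim_var p (if t = 1 then pilot_prob p else h) s)
    / (stage_prop p 1 * sqrt (pilot_prob p s) + stage_prop p 2 * sqrt (h s))"
  unfolding arm_weight_def unfolding assms weight.simps sum_stages by simp

lemma arm_weight_Constant:
  assumes "w = Constant"
  shows "arm_weight h t s = sqrt (stage_prop p t * lim_var p (if t = 1 then pilot_prob p else h) s
    / (if t = 1 then pilot_prob p s else h s))"
  unfolding arm_weight_def unfolding assms weight.simps by simp

lemma stat_Unnormalized: "stat Unnormalized h a\<^sub>1 a\<^sub>2 =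
    (a\<^sub>1 $ 0 * arm_weight h 1 0 + a\<^sub>2 $ 0 * arm_weight h 2 0)
  - (a\<^sub>1 $ 1 * arm_weight h 1 1 + a\<^sub>2 $ 1 * arm_weight h 2 1)"
  unfolding stat_def weighted_stat.simps unnormalized_stat_def sum_stages arm_weight_def by simp

lemma stat_Normalized: "stat Normalized h a\<^sub>1 a\<^sub>2 = stat Unnormalized h a\<^sub>1 a\<^sub>2
    / sqrt (((arm_weight h 1 0)\<^sup>2 + (arm_weight h 2 0)\<^sup>2)
          + ((arm_weight h 1 1)\<^sup>2 + (arm_weight h 2 1)\<^sup>2))"
  unfolding stat_def weighted_stat.simps sum_stages sum_arms arm_weight_def ..

definition coupled_stat :: "scaling \<Rightarrow> ereal \<Rightarrow> (real ^ 2) \<times> (real ^ 2) \<Rightarrow> real" where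
  "coupled_stat v c = (\<lambda>(z, z'). stat v (followup_prob p c (pilot_vec z)) (pilot_vec z)
     (followup_vec c (pilot_vec z) z'))"

abbreviation noise :: "((real ^ 2) \<times> (real ^ 2)) measure" where
  "noise \<equiv> centered_normal (mat 1) \<Otimes>\<^sub>M centered_normal (mat 1)"

lemma measurable_pilot_vec [measurable]: "pilot_vec \<in> borel_measurable borel"
  unfolding pilot_vec_def by measurable

lemma measurable_lim_cov:
  assumes [measurable]: "\<And>s. (\<lambda>x. h x s) \<in> borel_measurable M"
  shows "(\<lambda>x. lim_cov p (h x)) \<in> borel_measurable M"
  unfolding lim_cov_def lim_var_def by measurable

lemma measurable_followup_vec:
  assumes "c \<le> 0"
  shows "case_prod (followup_vec c) \<in> borel_measurable (borel \<Otimes>\<^sub>M borel)"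
proof -
  note measurable_lim_cov[OF measurable_followup_prob[OF assms], measurable]
  show ?thesis
    unfolding followup_vec_def by measurable
qed

lemma measurable_arm_weight:
  assumes [measurable]: "\<And>s. (\<lambda>x. h x s) \<in> borel_measurable M"
  shows "(\<lambda>x. arm_weight (h x) t s) \<in> borel_measurable M"
proof (cases w)
  case Adaptive
  then show ?thesis
    unfolding arm_weight_Adaptive[OF Adaptive] lim_var_def
    by (cases "t = 1") simp_all
next
  case Constant
  then show ?thesis
    unfolding arm_weight_Constant[OF Constant] lim_var_def
    by (cases "t = 1") simp_all
qed

lemma measurable_stat:
  assumes h: "\<And>s. (\<lambda>x. h x s) \<in> borel_measurable M"
    and [measurable]: "a\<^sub>1 \<in> borel_measurable M" "a\<^sub>2 \<in> borel_measurable M"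
  shows "(\<lambda>x. stat v (h x) (a\<^sub>1 x) (a\<^sub>2 x)) \<in> borel_measurable M"
proof -
  note measurable_arm_weight[OF h, measurable]
  show ?thesis
    by (cases v) (simp_all only: stat_Unnormalized stat_Normalized, measurable)
qed

lemma joint_law_eq_distr:
  assumes c: "c \<le> 0"
  shows "joint_law p c = distr noise borel (\<lambda>(z, z'). (pilot_vec z, followup_vec c (pilot_vec z) z'))"
proof -
  have pilot: "centered_normal (lim_Sigma p (pilot_prob p))
      = distr (centered_normal (mat 1)) borel pilot_vec"
    using pilot_prob_split by (simp add: centered_normal_lim_Sigma pilot_vec_def[abs_def])
  have followup: "centered_normal (lim_Sigma p (followup_prob p c a))
      = distr (centered_normal (mat 1)) borel (followup_vec c a)" for a
    using followup_prob_split[OF c]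
    by (simp add: centered_normal_lim_Sigma followup_vec_def[abs_def])
  show ?thesis
    unfolding joint_law_def pilot followup
    by (rule bind_distr_kernel_eq_distr_pair)
       (simp_all add: prob_space_standard_normal measurable_pilot_vec measurable_followup_vec c)
qed

lemma measurable_coupled_vec:
  assumes "c \<le> 0"
  shows "(\<lambda>(z, z'). followup_vec c (pilot_vec z) z') \<in> borel_measurable (borel \<Otimes>\<^sub>M borel)"
  using measurable_compose[OF _ measurable_followup_vec[OF assms],
      of "\<lambda>(z, z'). (pilot_vec z, z')" "borel \<Otimes>\<^sub>M borel"]
  by (simp add: case_prod_unfold)

lemma measurable_coupled_stat:
  assumes c: "c \<le> 0"
  shows "coupled_stat v c \<in> borel_measurable (borel \<Otimes>\<^sub>M borel)"
proof -
  note measurable_followup_prob[OF c, measurable]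
  show ?thesis
    unfolding coupled_stat_def case_prod_unfold
    using measurable_coupled_vec[OF c]
    by (intro measurable_stat) (simp_all add: case_prod_unfold)
qed

lemma limit_law_eq_distr:
  assumes c: "c \<le> 0"
  shows "limit_law v w p c = distr noise borel (coupled_stat v c)"
proof -
  have law: "limit_law v w p c
      = distr (joint_law p c) borel (\<lambda>(a\<^sub>1, a\<^sub>2). stat v (followup_prob p c a\<^sub>1) a\<^sub>1 a\<^sub>2)"
    by (simp add: limit_law_def stat_def)
  have "(\<lambda>x. stat v (followup_prob p c (fst x)) (fst x) (snd x)) \<in> borel_measurable (borel \<Otimes>\<^sub>M borel)"
    using measurable_compose[OF measurable_fst measurable_followup_prob[OF c]]
    by (intro measurable_stat) simp_all
  then have stat: "(\<lambda>(a\<^sub>1, a\<^sub>2). stat v (followup_prob p c a\<^sub>1) a\<^sub>1 a\<^sub>2) \<in> borel_measurable borel"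
    by (simp add: case_prod_unfold borel_prod)
  have vec: "(\<lambda>(z, z'). (pilot_vec z, followup_vec c (pilot_vec z) z')) \<in> noise \<rightarrow>\<^sub>M borel"
    using measurable_coupled_vec[OF c] unfolding borel_prod[symmetric]
    by (simp add: case_prod_unfold cong: measurable_cong_sets)
  show ?thesis
    unfolding law joint_law_eq_distr[OF c] by (subst distr_distr[OF stat vec])
      (simp add: coupled_stat_def comp_def case_prod_unfold)
qed

section \<open>Continuity and domination of the coupled statistics\<close>

lemma arm_weight_bound:
  assumes "h \<in> allocations" and "t = 1 \<or> t = 2"
  shows "\<bar>arm_weight h t s\<bar> \<le> weight_bound s"
proof -
  define H where "H t = (if t = 1 then pilot_prob p else h)" for t :: nat
  have q: "0 < stage_prop p t" "stage_prop p t \<le> 1"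
    using assms(2) stage_prop_pos stage_prop_sum by auto
  have H: "H t 0 + H t 1 = 1" "\<forall>s. 0 \<le> H t s"
    using assms(1) pilot_prob_split by (simp_all add: H_def allocations_def)
  have V: "0 < lim_var p (H t) s" "lim_var p (H t) s \<le> lim_second p s"
    using lim_var_bounds[OF H] by auto
  have qV: "stage_prop p t * lim_var p (H t) s \<le> lim_second p s"
    "0 < stage_prop p t * lim_var p (H t) s"
    using mult_mono[OF q(2) V(2)] q V by auto
  show ?thesis
  proof (cases w)
    case Adaptive
    define D where "D = stage_prop p 1 * sqrt (pilot_prob p s) + stage_prop p 2 * sqrt (h s)"
    have "0 < stage_prop p 1 * sqrt (pilot_prob p s)"
      using stage_prop_pos pilot_prob_pos by simp
    moreover have "stage_prop p 1 * sqrt (pilot_prob p s) \<le> D"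
      using assms(1) stage_prop_pos by (simp add: allocations_def D_def)
    ultimately have "sqrt (stage_prop p t * lim_var p (H t) s) / D
        \<le> sqrt (lim_second p s) / (stage_prop p 1 * sqrt (pilot_prob p s))"
      "0 \<le> sqrt (stage_prop p t * lim_var p (H t) s) / D"
      using qV V by (auto intro!: frac_le)
    then show ?thesis
      unfolding arm_weight_Adaptive[OF Adaptive] weight_bound_def H_def[symmetric] D_def[symmetric]
      by (simp only: Adaptive weighting.case abs_of_nonneg)
  next
    case Constant
    have m: "0 < min (pilot_prob p s) (lim_clip p)" "min (pilot_prob p s) (lim_clip p) \<le> H t s"
      using pilot_prob_pos[of s] lim_clip_pos[OF Constant] assms(1)
      by (auto simp: H_def allocations_def min.coboundedI1 min.coboundedI2)
    have "stage_prop p t * lim_var p (H t) s / H t s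
        \<le> lim_second p s / min (pilot_prob p s) (lim_clip p)"
      using qV V m by (intro frac_le) auto
    moreover have "0 \<le> stage_prop p t * lim_var p (H t) s / H t s"
      using qV(2) H(2) by (intro divide_nonneg_nonneg) auto
    ultimately show ?thesis
      unfolding arm_weight_Constant[OF Constant] weight_bound_def
      by (simp add: Constant H_def if_distribR)
  qed
qed

text \<open>
This keeps the normalizing constant positive, also in the limit.
\<close>

lemma arm_weight_pilot_pos:
  assumes "h \<in> allocations"
  shows "0 < arm_weight h 1 s"
proof -
  have V: "0 < stage_prop p 1 * lim_var p (pilot_prob p) s"
    using lim_var_bounds[of "pilot_prob p"] pilot_prob_split stage_prop_pos by simp
  show ?thesis
  proof (cases w)
    case Adaptive
    have "0 < stage_prop p 1 * sqrt (pilot_prob p s) + stage_prop p 2 * sqrt (h s)"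
      using assms stage_prop_pos pilot_prob_pos by (intro add_pos_nonneg) (auto simp: allocations_def)
    then show ?thesis
      using V by (simp add: arm_weight_Adaptive[OF Adaptive])
  next
    case Constant
    then show ?thesis
      using V pilot_prob_pos[of s] unfolding arm_weight_Constant[OF Constant] by simp
  qed
qed

lemma tendsto_lim_cov:
  assumes "\<And>s. ((\<lambda>x. h x s) \<longlongrightarrow> h' s) F" and h': "h' \<in> allocations"
  shows "((\<lambda>x. lim_cov p (h x)) \<longlongrightarrow> lim_cov p h') F"
proof -
  have "lim_var p h' s \<noteq> 0" for s
    using lim_var_bounds[of h' s] h' by (auto simp: allocations_def)
  then show ?thesis
    unfolding lim_cov_def lim_var_def by (intro tendsto_intros assms) (simp add: lim_var_def)
qed

lemma tendsto_cholesky_mult: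
  assumes "(r \<longlongrightarrow> r') F"
  shows "((\<lambda>x. (cholesky (r x) *v z) $ i) \<longlongrightarrow> (cholesky r' *v z) $ i) F"
proof -
  have "\<forall>i. ((\<lambda>x. (cholesky (r x) *v z) $ i) \<longlongrightarrow> (cholesky r' *v z) $ i) F"
    unfolding all_arms cholesky_mult by (intro conjI tendsto_intros assms)
  then show ?thesis ..
qed

lemma tendsto_arm_weight:
  assumes h: "\<And>s. ((\<lambda>x. h x s) \<longlongrightarrow> h' s) F" and h': "h' \<in> allocations"
  shows "((\<lambda>x. arm_weight (h x) t s) \<longlongrightarrow> arm_weight h' t s) F"
proof (cases w)
  case Adaptive
  have "0 < stage_prop p 1 * sqrt (pilot_prob p s) + stage_prop p 2 * sqrt (h' s)"
    using h' stage_prop_pos pilot_prob_pos by (intro add_pos_nonneg) (auto simp: allocations_def)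
  then show ?thesis
    unfolding arm_weight_Adaptive[OF Adaptive] lim_var_def
    by (cases "t = 1") (simp_all, (intro tendsto_intros h; simp)+)
next
  case Constant
  have "0 < h' s"
    using h' lim_clip_pos[OF Constant] by (auto simp: allocations_def intro: less_le_trans)
  then show ?thesis
    unfolding arm_weight_Constant[OF Constant] lim_var_def
    by (cases "t = 1") (simp_all, (intro tendsto_intros h; simp))
qed

lemma tendsto_stat:
  assumes h: "\<And>s. ((\<lambda>x. h x s) \<longlongrightarrow> h' s) F" and h': "h' \<in> allocations"
    and a: "\<And>s. ((\<lambda>x. a x $ s) \<longlongrightarrow> a' $ s) F"
  shows "((\<lambda>x. stat v (h x) a\<^sub>1 (a x)) \<longlongrightarrow> stat v h' a\<^sub>1 a') F"
proof -
  note lim = tendsto_arm_weight[OF h h'] a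
  have unnormalized: "((\<lambda>x. stat Unnormalized (h x) a\<^sub>1 (a x)) \<longlongrightarrow> stat Unnormalized h' a\<^sub>1 a') F"
    unfolding stat_Unnormalized by (intro tendsto_intros lim)
  have "0 < ((arm_weight h' 1 0)\<^sup>2 + (arm_weight h' 2 0)\<^sup>2)
      + ((arm_weight h' 1 1)\<^sup>2 + (arm_weight h' 2 1)\<^sup>2)"
    using arm_weight_pilot_pos[OF h', of 0] by (intro add_pos_nonneg) simp_all
  then show ?thesis
    by (cases v) (simp_all only: stat_Normalized unnormalized, intro tendsto_intros lim unnormalized, simp)
qed

text \<open>
Without normalization the weights are at most \<open>weight_bound\<close>. With normalization each weight is at most
the normalizing constant \<open>D\<close>, which accounts for the 1 in the maximum.
\<close>

lemma abs_stat_le: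
  assumes h: "h \<in> allocations"
  shows "\<bar>stat v h a\<^sub>1 a\<^sub>2\<bar> \<le> max 1 (weight_bound 0 + weight_bound 1)
     * (\<bar>a\<^sub>1 $ 0\<bar> + \<bar>a\<^sub>2 $ 0\<bar> + \<bar>a\<^sub>1 $ 1\<bar> + \<bar>a\<^sub>2 $ 1\<bar>)" (is "_ \<le> _ * ?S")
proof -
  have triangle: "\<bar>stat Unnormalized h a\<^sub>1 a\<^sub>2\<bar> \<le> D * ?S"
    if D: "\<And>s. \<bar>arm_weight h 1 s\<bar> \<le> D" "\<And>s. \<bar>arm_weight h 2 s\<bar> \<le> D" for D
  proof -
    have "- (D * \<bar>a\<bar>) \<le> a * arm_weight h t s \<and> a * arm_weight h t s \<le> D * \<bar>a\<bar>"
      if "t = 1 \<or> t = 2" for a t s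
      using that D[of s] abs_le_D1[of "a * arm_weight h t s"] abs_le_D2[of "a * arm_weight h t s"]
        mult_left_mono[of "\<bar>arm_weight h t s\<bar>" D "\<bar>a\<bar>"]
      by (auto simp: abs_mult mult.commute minus_le_iff)
    from this[of 1 "a\<^sub>1 $ 0" 0] this[of 1 "a\<^sub>1 $ 1" 1] this[of 2 "a\<^sub>2 $ 0" 0] this[of 2 "a\<^sub>2 $ 1" 1]
    show ?thesis
      unfolding stat_Unnormalized distrib_left abs_le_iff by linarith
  qed
  show ?thesis
  proof (cases v)
    case Unnormalized
    have "\<forall>s. weight_bound s \<le> max 1 (weight_bound 0 + weight_bound 1)"
      using arm_weight_bound[OF h, of 1 0] arm_weight_bound[OF h, of 1 1] by (auto simp: all_arms)
    then show ?thesis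
      unfolding Unnormalized using arm_weight_bound[OF h]
      by (intro triangle) (blast intro: order_trans)+
  next
    case Normalized
    define D where "D = sqrt (((arm_weight h 1 0)\<^sup>2 + (arm_weight h 2 0)\<^sup>2)
        + ((arm_weight h 1 1)\<^sup>2 + (arm_weight h 2 1)\<^sup>2))"
    have "\<forall>s. \<bar>arm_weight h 1 s\<bar> \<le> D" "\<forall>s. \<bar>arm_weight h 2 s\<bar> \<le> D"
      unfolding D_def all_arms by (auto intro!: real_le_rsqrt)
    then have "\<bar>stat Unnormalized h a\<^sub>1 a\<^sub>2\<bar> \<le> D * ?S" "0 \<le> D"
      by (auto intro: triangle simp: D_def)
    then have "\<bar>stat Normalized h a\<^sub>1 a\<^sub>2\<bar> \<le> 1 * ?S"
      unfolding stat_Normalized D_def[symmetric]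
      \<comment> \<open>If \<open>D\<close> vanishes, the quotient is zero by the convention on division.\<close>
      by (cases "D = 0") (simp_all add: abs_div field_simps)
    also have "\<dots> \<le> max 1 (weight_bound 0 + weight_bound 1) * ?S"
      by (intro mult_right_mono) simp_all
    finally show ?thesis
      unfolding Normalized .
  qed
qed

lemma followup_prob_allocations: "c \<le> 0 \<Longrightarrow> followup_prob p c a \<in> allocations"
  using followup_prob_split by (simp add: allocations_def)

text \<open>
An integrable bound for all coupled statistics at once: each coordinate of a Gaussian vector is at
most the sum of the absolute values of the noise coordinates of its stage, and there are two
coordinates at each stage.
\<close>

definition envelope :: "(real ^ 2) \<times> (real ^ 2) \<Rightarrow> real" where
  "envelope = (\<lambda>(z, z'). max 1 (weight_bound 0 + weight_bound 1)
     * (2 * (\<bar>z $ 0\<bar> + \<bar>z $ 1\<bar>) + 2 * (\<bar>z' $ 0\<bar> + \<bar>z' $ 1\<bar>)))"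

lemma abs_coupled_stat_le:
  assumes c: "c \<le> 0"
  shows "\<bar>coupled_stat v c x\<bar> \<le> envelope x"
proof (cases x)
  case (Pair z z')
  define a\<^sub>1 where "a\<^sub>1 = pilot_vec z"
  define a\<^sub>2 where "a\<^sub>2 = followup_vec c a\<^sub>1 z'"
  have a1: "\<bar>a\<^sub>1 $ s\<bar> \<le> \<bar>z $ 0\<bar> + \<bar>z $ 1\<bar>" for s
    unfolding a\<^sub>1_def pilot_vec_def using pilot_prob_split
    by (intro abs_cholesky_mult_le less_imp_le abs_lim_cov_less_1) auto
  have a2: "\<bar>a\<^sub>2 $ s\<bar> \<le> \<bar>z' $ 0\<bar> + \<bar>z' $ 1\<bar>" for s
    unfolding a\<^sub>2_def followup_vec_def using followup_prob_split[OF c]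
    by (intro abs_cholesky_mult_le less_imp_le abs_lim_cov_less_1) auto
  have "\<bar>coupled_stat v c x\<bar> \<le> max 1 (weight_bound 0 + weight_bound 1)
      * (\<bar>a\<^sub>1 $ 0\<bar> + \<bar>a\<^sub>2 $ 0\<bar> + \<bar>a\<^sub>1 $ 1\<bar> + \<bar>a\<^sub>2 $ 1\<bar>)"
    unfolding coupled_stat_def Pair prod.case a\<^sub>1_def a\<^sub>2_def
    by (intro abs_stat_le followup_prob_allocations c)
  also have "\<dots> \<le> envelope x"
    unfolding envelope_def Pair prod.case
    using a1[of 0] a1[of 1] a2[of 0] a2[of 1]
    by (intro mult_left_mono) (auto simp: le_max_iff_disj)
  finally show ?thesis .
qed

lemma tendsto_coupled_stat:
  "((\<lambda>c. coupled_stat v c x) \<longlongrightarrow> coupled_stat v (-\<infinity>) x) (at (-\<infinity>) within {..0})"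
proof (cases x)
  case (Pair z z')
  have "followup_prob p (-\<infinity>) a \<in> allocations" for a
    by (rule followup_prob_allocations) simp
  then show ?thesis
    unfolding Pair coupled_stat_def prod.case followup_vec_def
    by (intro tendsto_stat tendsto_cholesky_mult tendsto_lim_cov tendsto_followup_prob)
qed

lemma prob_space_noise: "prob_space noise"
  by (intro prob_space_pair prob_space_standard_normal)

lemma integrable_envelope: "integrable noise envelope"
proof -
  let ?Z = "centered_normal (mat 1) :: (real ^ 2) measure"
  interpret Z: prob_space ?Z by (rule prob_space_standard_normal)
  have comp: "integrable ?Z (\<lambda>z. z $ s)" for s
    using integrable_standard_normal_inner[of "axis s 1"] by (simp add: inner_axis)
  interpret pair_prob_space ?Z ?Z ..
  have fst: "integrable noise (\<lambda>x. fst x $ s)" for s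
    using comp[of s] integrable_distr_eq[of fst noise ?Z "\<lambda>z. z $ s"]
    by (simp add: Z.distr_pair_fst)
  moreover have "integrable noise (\<lambda>x. snd x $ s)" for s
    using fst[of s] integrable_product_swap_iff[of "\<lambda>x. fst x $ s"]
    by (simp add: case_prod_unfold)
  ultimately show ?thesis
    unfolding envelope_def case_prod_unfold
    by (intro integrable_mult_right Bochner_Integration.integrable_add integrable_abs)
qed

text \<open>
The coupled statistics converge at every point of the noise space and are dominated by the envelope,
so their mean distance, which bounds the Wasserstein distance, vanishes in the limit.
\<close>

theorem wasserstein1_limit_law_tendsto_0:
  "((\<lambda>c. wasserstein1 (limit_law v w p (-\<infinity>)) (limit_law v w p c)) \<longlongrightarrow> 0) (at (-\<infinity>) within {..0})"
  unfolding tendsto_at_iff_sequentially comp_def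
proof (intro allI impI)
  fix c :: "nat \<Rightarrow> ereal"
  assume c: "\<forall>n. c n \<in> {..0} - {-\<infinity>}" and lim: "c \<longlonglongrightarrow> -\<infinity>"
  interpret prob_space noise by (rule prob_space_noise)
  have c0: "c n \<le> 0" for n
    using c by auto
  have meas [measurable]: "coupled_stat v b \<in> borel_measurable noise" if "b \<le> 0" for b
    using measurable_coupled_stat[OF that] by (simp cong: measurable_cong_sets)
  have int: "integrable noise (coupled_stat v b)" if "b \<le> 0" for b
    using abs_coupled_stat_le[OF that]
    by (intro Bochner_Integration.integrable_bound[OF integrable_envelope] meas that AE_I2)
       (simp add: order_trans[OF _ abs_ge_self])
  let ?d = "\<lambda>n x. \<bar>coupled_stat v (-\<infinity>) x - coupled_stat v (c n) x\<bar>"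
  have "(\<lambda>n. integral\<^sup>L noise (?d n)) \<longlonglongrightarrow> (\<integral>x. 0 \<partial>noise)"
  proof (rule integral_dominated_convergence[where w = "\<lambda>x. 2 * envelope x"])
    show "integrable noise (\<lambda>x. 2 * envelope x)"
      using integrable_envelope by simp
    show "?d n \<in> borel_measurable noise" for n
      using meas[of "-\<infinity>"] meas[OF c0] by simp
    show "AE x in noise. norm (?d n x) \<le> 2 * envelope x" for n
    proof (rule AE_I2)
      fix x show "norm (?d n x) \<le> 2 * envelope x"
        using abs_coupled_stat_le[of "-\<infinity>" v x] abs_coupled_stat_le[OF c0, of v n x] by simp
    qed
    show "AE x in noise. (\<lambda>n. ?d n x) \<longlonglongrightarrow> 0"
    proof (rule AE_I2)
      fix x
      have "(\<lambda>n. coupled_stat v (c n) x) \<longlonglongrightarrow> coupled_stat v (-\<infinity>) x"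
        using tendsto_coupled_stat[of v x, unfolded tendsto_at_iff_sequentially comp_def] c lim by blast
      from tendsto_rabs[OF tendsto_diff[OF tendsto_const[of "coupled_stat v (-\<infinity>) x"] this]]
      show "(\<lambda>n. ?d n x) \<longlonglongrightarrow> 0" by simp
    qed
  qed simp
  then have upper: "(\<lambda>n. ereal (integral\<^sup>L noise (?d n))) \<longlonglongrightarrow> 0"
    by (simp add: zero_ereal_def)
  show "(\<lambda>n. wasserstein1 (limit_law v w p (-\<infinity>)) (limit_law v w p (c n))) \<longlonglongrightarrow> 0"
  proof (rule tendsto_sandwich[OF _ _ tendsto_const upper])
    show "\<forall>\<^sub>F n in sequentially. wasserstein1 (limit_law v w p (-\<infinity>)) (limit_law v w p (c n))
        \<le> ereal (integral\<^sup>L noise (?d n))"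
      using prob_space_noise int c0
      by (intro always_eventually allI) (simp add: limit_law_eq_distr wasserstein1_distr_le)
  qed (simp add: wasserstein1_nonneg)
qed

end

section \<open>Limits of two-stage experiments\<close>

lemma lipschitz_design_regular:
  assumes "lipschitz_design e"
  shows "(\<lambda>x. e s (ereal x)) \<in> borel_measurable borel"
    and "(e s \<longlongrightarrow> e s (-\<infinity>)) (at (-\<infinity>) within rbar)"
proof -
  obtain L where "L-lipschitz_on UNIV (\<lambda>x. e s (ereal x))"
    and cont: "continuous (at (-\<infinity>) within rbar) (e s)"
    using assms unfolding lipschitz_design_def by blast
  then show "(\<lambda>x. e s (ereal x)) \<in> borel_measurable borel"
    by (intro borel_measurable_continuous_onI lipschitz_on_continuous_on)
  show "(e s \<longlongrightarrow> e s (-\<infinity>)) (at (-\<infinity>) within rbar)"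
    using cont by (simp add: continuous_within)
qed

text \<open>
Near minus infinity the transformed statistic \<open>g x\<close> lies in the first cell, so the sampling function
is constant there. It is measurable because all cells are Borel sets.
\<close>

lemma step_design_regular:
  assumes "step_design e"
  shows "(\<lambda>x. e s (ereal x)) \<in> borel_measurable borel"
    and "(e s \<longlongrightarrow> e s (-\<infinity>)) (at (-\<infinity>) within rbar)"
proof -
  obtain m\<^sub>1 :: real and K :: nat and g :: "ereal \<Rightarrow> ereal" and c :: "nat \<Rightarrow> 2 \<Rightarrow> real"
    and C :: "nat \<Rightarrow> ereal set"
    where g: "continuous_on rbar g" "g (-\<infinity>) = -\<infinity>"
      and disj: "disjoint_family_on C {1..K}"
      and C1: "C 1 = {-\<infinity>..ereal m\<^sub>1}"
      and C_open: "\<forall>k\<in>{2..K}. open (C k)"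
      and cover: "(\<Union>k\<in>{2..K}. C k) = {ereal m\<^sub>1<..<\<infinity>}"
      and e: "\<forall>s. \<forall>x\<in>rbar. e s x = (\<Sum>k=1..K. c k s * indicator (C k) (g x))"
    using assms unfolding step_design_def by (elim exE conjE) (rule that; assumption)
  have real_rbar: "ereal x \<in> rbar" for x
    by (simp add: rbar_def)
  have C_borel: "C k \<in> sets borel" if "k \<in> {1..K}" for k
    using that C1 C_open by (cases "k = 1") auto
  have "continuous_on UNIV (\<lambda>x. g (ereal x))"
    using real_rbar
    by (intro continuous_on_compose2[OF g(1)] continuous_on_ereal continuous_on_id) blast
  then have [measurable]: "(\<lambda>x. g (ereal x)) \<in> borel_measurable borel"
    by (rule borel_measurable_continuous_onI)
  have "(\<lambda>x. \<Sum>k=1..K. c k s * indicator (C k) (g (ereal x))) \<in> borel_measurable borel"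
    using C_borel by (intro borel_measurable_sum borel_measurable_times borel_measurable_const) simp
  then show "(\<lambda>x. e s (ereal x)) \<in> borel_measurable borel"
    using e real_rbar by simp

  \<comment> \<open>The cells after the first have a non-empty union, so there are at least two cells and the index of the
    first one is in range.\<close>
  have "ereal (m\<^sub>1 + 1) \<in> (\<Union>k\<in>{2..K}. C k)"
    unfolding cover by simp
  then have K: "1 \<in> {1..K}"
    by auto
  have const: "e s x = c 1 s" if x: "x \<in> rbar" "g x \<le> ereal m\<^sub>1" for x
  proof -
    have in_C1: "g x \<in> C 1"
      using x unfolding C1 by simp
    have ind: "indicator (C k) (g x) = (if k = 1 then 1 else 0 :: real)" if "k \<in> {1..K}" for k
      using in_C1 disjoint_family_onD[OF disj K that] by (auto simp: indicator_def)
    have "e s x = (\<Sum>k=1..K. c k s * indicator (C k) (g x))"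
      using e x by blast
    also have "\<dots> = (\<Sum>k=1..K. if k = 1 then c k s else 0)"
      by (rule sum.cong[OF refl]) (simp add: ind del: One_nat_def)
    also have "\<dots> = c 1 s"
      using K by (simp add: sum.delta' del: One_nat_def)
    finally show ?thesis .
  qed
  have "(g \<longlongrightarrow> -\<infinity>) (at (-\<infinity>) within rbar)"
    using g(1)[unfolded continuous_on_def, rule_format, of "-\<infinity>"] g(2) by (simp add: rbar_def)
  then have "eventually (\<lambda>x. g x < ereal m\<^sub>1) (at (-\<infinity>) within rbar)"
    by (rule order_tendstoD) simp
  moreover have "eventually (\<lambda>x. x \<in> rbar) (at (-\<infinity>) within rbar)"
    by (simp add: eventually_at_filter)
  ultimately have "eventually (\<lambda>x. e s x = e s (-\<infinity>)) (at (-\<infinity>) within rbar)"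
  proof eventually_elim
    case (elim x)
    then show ?case
      using const[of x] const[of "-\<infinity>"] g(2) by (simp add: rbar_def)
  qed
  then show "(e s \<longlongrightarrow> e s (-\<infinity>)) (at (-\<infinity>) within rbar)"
    by (rule tendsto_eventually)
qed

text \<open>
The uniform lower bound on the variances passes to the limit of the moments.
\<close>

lemma moment_conditions_variance_pos:
  assumes "moment_conditions p Nt P"
  shows "(lim_mean p s)\<^sup>2 < lim_second p s"
proof -
  let ?var = "\<lambda>n. moment P 2 s n - (moment P 1 s n)\<^sup>2"
  have pos: "0 < (INF n. ereal (?var n))"
    and lim: "moment P 1 s \<longlonglongrightarrow> lim_mean p s" "moment P 2 s \<longlonglongrightarrow> lim_second p s"
    using assms unfolding moment_conditions_def by auto
  have "(\<lambda>n. ereal (?var n)) \<longlonglongrightarrow> ereal (lim_second p s - (lim_mean p s)\<^sup>2)"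
    by (intro tendsto_intros lim)
  then have "(INF n. ereal (?var n)) \<le> ereal (lim_second p s - (lim_mean p s)\<^sup>2)"
    by (rule LIMSEQ_le_const) (auto intro: INF_lower)
  with pos have "0 < ereal (lim_second p s - (lim_mean p s)\<^sup>2)"
    by (rule less_le_trans)
  then show ?thesis by simp
qed

theorem theorem3:
  fixes p :: limit_params
    and Nt :: "nat \<Rightarrow> nat \<Rightarrow> nat"
    and P :: "nat \<Rightarrow> (real ^ 2) measure"
    and l :: "nat \<Rightarrow> real"
    and v :: scaling
    and w :: weighting
  assumes "two_stage_experiment p Nt P l"
    and "moment_conditions p Nt P"
    and "sampling_design_conditions p"
    and "weighting_regime w Nt l"
  shows "((\<lambda>c. wasserstein1 (limit_law v w p (-\<infinity>)) (limit_law v w p c)) \<longlongrightarrow> 0)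
           (at (-\<infinity>) within {..0})"
proof -
  have stage: "0 < stage_prop p 1" "0 < stage_prop p 2" "stage_prop p 1 + stage_prop p 2 = 1"
    and pilot_sum: "pilot_prob p 0 + pilot_prob p 1 = 1"
    and l: "\<And>n. l n \<in> {0..<1/2}" "l \<longlonglongrightarrow> lim_clip p"
    using assms(1) unfolding two_stage_experiment_def by auto
  have clip_pos: "0 < lim_clip p" if w: "w = Constant"
  proof -
    obtain b where "0 < b" "\<forall>n. l n = b"
      using assms(4) unfolding w weighting_regime.simps by auto
    then have "l = (\<lambda>_. b)" by auto
    with l(2) \<open>0 < b\<close> show ?thesis
      by (simp add: LIMSEQ_const_iff)
  qed
  have design: "lipschitz_design (sampling p) \<or> step_design (sampling p)"
    using assms(3) unfolding sampling_design_conditions_def by blast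
  interpret limit_setting p w
  proof
    show "0 \<le> lim_clip p"
      by (rule LIMSEQ_le_const[OF l(2)]) (use l(1) in auto)
    show "lim_clip p \<le> 1 / 2"
      by (rule LIMSEQ_le_const2[OF l(2)]) (use l(1) in \<open>auto intro: less_imp_le\<close>)
    show "0 < pilot_prob p s" for s
      using assms(3) unfolding sampling_design_conditions_def by (auto intro: less_trans)
    show "sampling p 0 x + sampling p 1 x = 1" if "x \<in> rbar" for x
      using assms(3) that unfolding sampling_design_conditions_def by blast
    show "(\<lambda>x. sampling p s (ereal x)) \<in> borel_measurable borel" for s
      using design lipschitz_design_regular(1) step_design_regular(1) by blast
    show "(sampling p s \<longlongrightarrow> sampling p s (-\<infinity>)) (at (-\<infinity>) within rbar)" for s
      using design lipschitz_design_regular(2) step_design_regular(2) by blast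
  qed (use stage pilot_sum clip_pos moment_conditions_variance_pos[OF assms(2)] in simp_all)
  show ?thesis
    by (rule wasserstein1_limit_law_tendsto_0)
qed

end
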